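(* Let $a_0\in\mathbb{R}$ and let $TI$ be a topological index of one of the two forms $TI(G)=\sum_{v\in V(G)}h(d_v)^{a_0}$ with $h:\{1,2,\dots\}\to(0,\infty)$, or $TI(G)=\sum_{uv\in E(G)}f(d_u,d_v)^{a_0}$ with $f:\{1,2,\dots\}\times\{1,2,\dots\}\to(0,\infty)$ symmetric. Let $n\ge2$, let $RSC_n=RSC(n,p_1,p_2,p_3)$ be a random spiro chain, $TI_n=TI(RSC_n)$, and for $i=1,2,3$ put $\alpha_i=TI(RSC_3^i)-TI_2$. Then $$TI_n=TI_2+a^TX,$$ where $a^T=(\alpha_1,\alpha_2,\alpha_3)$ and $X=(X_1,X_2,X_3)$ is a multinomial random vector with parameters $n-2$ and $(p_1,p_2,p_3)$.
   Context: For a finite simple graph $G$, $V(G)$ and $E(G)$ are its vertex and edge sets and $d_v$ is the degree of the vertex $v$. Random spiro chain. Fix $p_1,p_2,p_3$ with $0<p_i<1$ and $p_1+p_2+p_3=1$. The random spiro chain $RSC_n=RSC(n,p_1,p_2,p_3)$ with $n$ hexagons is built as follows. $RSC_1$ is a hexagon $H_1$ (a 6-cycle). $RSC_2$ consists of two hexagons $H_1,H_2$ sharing exactly one vertex. For $n>2$, $RSC_n$ is obtained from $RSC_{n-1}$ by attaching a new hexagon $H_n$ to the last hexagon $H_{n-1}$, identifying one vertex of $H_n$ with a vertex $w$ of $H_{n-1}$, where $w$ is at distance $i\in\{1,2,3\}$ (in the 6-cycle $H_{n-1}$) from the vertex that $H_{n-1}$ shares with $H_{n-2}$. The resulting graph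 is denoted $RSC_n^i$. Case $i$ is chosen with probability $p_i$, independently of the previous choices; $L_n\in\{1,2,3\}$ denotes the choice made at step $n$, so $\mathbb{P}(L_n=i)=p_i$. The graph $RSC_2$ and the graphs $RSC_3^1,RSC_3^2,RSC_3^3$ are deterministic (up to isomorphism), so $TI_2$ and $TI(RSC_3^i)$ are constants. The identity in the claim asserts that such a random vector $X$ exists (on the same probability space as the chain). *)

theory Defs
  imports "HOL-Probability.Probability"
begin

record 'a ugraph =
  verts :: "'a set"
  edges :: "'a set set"

definition degree :: "'a ugraph \<Rightarrow> 'a \<Rightarrow> nat" where
  "degree G v = card {e \<in> edges G. v \<in> e}"

(* Length of a shortest walk; only meaningful for vertices u, v that are connected in G. *)
definition gdist :: "'a ugraph \<Rightarrow> 'a \<Rightarrow> 'a \<Rightarrow> nat" where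
  "gdist G u v = (LEAST k. (u, v) \<in> {(x, y). {x, y} \<in> edges G} ^^ k)"

definition hexagon :: "'a ugraph \<Rightarrow> bool" where
  "hexagon G \<longleftrightarrow> (\<exists>c :: nat \<Rightarrow> 'a. inj_on c {..<6} \<and> verts G = c ` {..<6} \<and>
     edges G = (\<lambda>i. {c i, c ((i + 1) mod 6)}) ` {..<6})"

definition vertex_index :: "(nat \<Rightarrow> real) \<Rightarrow> real \<Rightarrow> 'a ugraph \<Rightarrow> real" where
  "vertex_index h a G = (\<Sum>v\<in>verts G. h (degree G v) powr a)"

(* The value described by THE is unique because f is only used when it is symmetric
   on positive degrees. *)
definition edge_index :: "(nat \<Rightarrow> nat \<Rightarrow> real) \<Rightarrow> real \<Rightarrow> 'a ugraph \<Rightarrow> real" where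
  "edge_index f a G =
     (\<Sum>e\<in>edges G. THE t. \<exists>u v. e = {u, v} \<and> t = f (degree G u) (degree G v) powr a)"

definition topological_index :: "real \<Rightarrow> ('a ugraph \<Rightarrow> real) \<Rightarrow> bool" where
  "topological_index a TI \<longleftrightarrow>
     (\<exists>h. (\<forall>d\<ge>1. 0 < h d) \<and> TI = vertex_index h a) \<or>
     (\<exists>f. (\<forall>d\<ge>1. \<forall>e\<ge>1. 0 < f d e \<and> f d e = f e d) \<and> TI = edge_index f a)"

definition hex_union :: "(nat \<Rightarrow> 'a ugraph) \<Rightarrow> nat \<Rightarrow> 'a ugraph" where
  "hex_union H n = \<lparr>verts = (\<Union>k\<in>{1..n}. verts (H k)), edges = (\<Union>k\<in>{1..n}. edges (H k))\<rparr>"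

(* The hexagons H 1, ..., H n form a spiro chain in which step k \<ge> 3 uses case l k.
   Identifying a vertex of the new hexagon with a vertex w k of the previous one is expressed
   by letting H k meet the union of its predecessors in exactly the vertex w k. *)
definition spiro_hexagons ::
    "(nat \<Rightarrow> nat) \<Rightarrow> nat \<Rightarrow> (nat \<Rightarrow> 'a ugraph) \<Rightarrow> (nat \<Rightarrow> 'a) \<Rightarrow> bool" where
  "spiro_hexagons l n H w \<longleftrightarrow>
     (\<forall>k\<in>{1..n}. hexagon (H k)) \<and>
     (\<forall>k\<in>{2..n}. w k \<in> verts (H (k - 1)) \<and> verts (hex_union H (k - 1)) \<inter> verts (H k) = {w k}) \<and>
     (\<forall>k\<in>{3..n}. gdist (H (k - 1)) (w (k - 1)) (w k) = l k)"

definition spiro_chain :: "(nat \<Rightarrow> nat) \<Rightarrow> nat \<Rightarrow> 'a ugraph \<Rightarrow> bool" where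
  "spiro_chain l n G \<longleftrightarrow> (\<exists>H w. spiro_hexagons l n H w \<and> G = hex_union H n)"

(* L n is the case chosen at step n \<ge> 3. In each outcome all the graphs G n come from one
   sequence of hexagons, so G n extends G (n - 1); the choice between the two vertices at
   distance 1 or 2, and the names of new vertices, may depend on the outcome in any way. *)
locale random_spiro_chain = prob_space M for M :: "'w measure" +
  fixes p :: "nat \<Rightarrow> real"
    and L :: "nat \<Rightarrow> 'w \<Rightarrow> nat"
    and G :: "nat \<Rightarrow> 'w \<Rightarrow> 'a ugraph"
  assumes p_range: "\<And>i. i \<in> {1, 2, 3} \<Longrightarrow> 0 < p i \<and> p i < 1"
    and p_sum: "p 1 + p 2 + p 3 = 1"
    and L_indep: "indep_vars (\<lambda>_. count_space {1, 2, 3}) L {3..}"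
    and L_prob: "\<And>n i. n \<ge> 3 \<Longrightarrow> i \<in> {1, 2, 3} \<Longrightarrow> prob {\<omega> \<in> space M. L n \<omega> = i} = p i"
    and chain: "\<And>\<omega>. \<omega> \<in> space M \<Longrightarrow>
      \<exists>H w. \<forall>n\<ge>1. spiro_hexagons (\<lambda>k. L k \<omega>) n H w \<and> G n \<omega> = hex_union H n"

definition multinomial_vector ::
    "'w measure \<Rightarrow> nat \<Rightarrow> 'i set \<Rightarrow> ('i \<Rightarrow> real) \<Rightarrow> ('i \<Rightarrow> 'w \<Rightarrow> nat) \<Rightarrow> bool" where
  "multinomial_vector M m I p X \<longleftrightarrow>
     (\<forall>i\<in>I. X i \<in> measurable M (count_space UNIV)) \<and>
     (\<forall>x. measure M {\<omega> \<in> space M. \<forall>i\<in>I. X i \<omega> = x i} =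
        (if (\<Sum>i\<in>I. x i) = m then fact m / (\<Prod>i\<in>I. fact (x i)) * (\<Prod>i\<in>I. p i ^ x i) else 0))"

end

theory Submission
  imports Defs
begin

text \<open>
  A vertex shared by two consecutive hexagons of a spiro chain has degree 4 and every other vertex
  has degree 2, so a topological index only depends on how many vertices and edges of each
  degree type there are. The chain has \<open>5 * n + 1\<close> vertices, \<open>n - 1\<close> of which have degree 4, in
  every outcome. The degree types of its \<open>6 * n\<close> edges depend on the choices made during the
  construction only through the number of edges with both ends of degree 4: there is one for each
  step at which the two shared vertices of a hexagon are adjacent, that is, for each use of case 1.
  The other edge counts then follow, because the number of pairs consisting of an edge and an end
  of degree 4 is \<open>4 * (n - 1)\<close>.

  Hence the index of a chain of \<open>n\<close> hexagons is \<open>A + B * n + C * N\<close>, where \<open>N\<close> counts the uses of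
  case 1 (lemma \<open>topological_index_chain\<close>). Evaluating this at the chains with two and
  three hexagons gives \<open>\<alpha> 1 = B + C\<close> and \<open>\<alpha> 2 = \<alpha> 3 = B\<close>. Let \<open>X i\<close> be the number of uses of
  case \<open>i\<close> in the steps \<open>3, ..., n\<close>. These numbers add up to \<open>n - 2\<close>, so the claimed identity is
  the closed form rewritten, and \<open>X\<close> is multinomial because it counts the outcomes of independent
  identically distributed trials (lemma \<open>multinomial_vector_of_indep_vars\<close>).
\<close>

section \<open>Hexagons\<close>

text \<open>
  Both orders of the cycle are recorded as distinct lists, so that the simplifier
  finds each inequality between two vertices in either orientation.
\<close>
lemma hexagonE:
  assumes "hexagon H"
  obtains a b c d e f where "distinct [a, b, c, d, e, f]" "distinct [f, e, d, c, b, a]"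
    "verts H = {a, b, c, d, e, f}"
    "edges H = {{a, b}, {b, c}, {c, d}, {d, e}, {e, f}, {f, a}}"
proof -
  from assms obtain x :: "nat \<Rightarrow> 'a" where inj: "inj_on x {..<6}"
    and V: "verts H = x ` {..<6}" and E: "edges H = (\<lambda>i. {x i, x ((i + 1) mod 6)}) ` {..<6}"
    unfolding hexagon_def by blast
  have six: "{..<6} = {0, 1, 2, 3, 4, 5::nat}" by auto
  show thesis
    by (rule that[of "x 0" "x 1" "x 2" "x 3" "x 4" "x 5"])
       (use inj V E in \<open>simp_all add: six inj_on_def flip: numeral_2_eq_2\<close>)
qed

lemma hexagon_card_verts: "hexagon H \<Longrightarrow> finite (verts H) \<and> card (verts H) = 6"
  by (erule hexagonE) simp

lemma hexagon_card_edges: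
  assumes "hexagon H" shows "finite (edges H)" "card (edges H) = 6"
proof -
  from assms obtain a b c d e f where *: "distinct [a, b, c, d, e, f]"
    "edges H = {{a, b}, {b, c}, {c, d}, {d, e}, {e, f}, {f, a}}" by (rule hexagonE)
  have "distinct [{a, b}, {b, c}, {c, d}, {d, e}, {e, f}, {f, a}]"
    using *(1) by (auto simp: doubleton_eq_iff)
  from distinct_card[OF this] show "card (edges H) = 6" by (simp add: *(2))
  show "finite (edges H)" by (simp add: *(2))
qed

lemma hexagon_edge:
  assumes "hexagon H" "e \<in> edges H" shows "e \<subseteq> verts H" "card e = 2"
  using assms by (auto elim!: hexagonE)

lemma hexagon_degree:
  assumes "hexagon H" shows "degree H v = (if v \<in> verts H then 2 else 0)"
proof -
  from assms obtain a b c d e f where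
    *: "distinct [a, b, c, d, e, f]" "distinct [f, e, d, c, b, a]"
    "verts H = {a, b, c, d, e, f}"
    "edges H = {{a, b}, {b, c}, {c, d}, {d, e}, {e, f}, {f, a}}" by (rule hexagonE)
  show ?thesis
  proof (cases "v \<in> verts H")
    case True
    then consider "v = a" | "v = b" | "v = c" | "v = d" | "v = e" | "v = f" using * by auto
    then show ?thesis
      by cases (use *(1,2) in \<open>simp_all add: degree_def *(3,4) conj_disj_distribR Collect_disj_eq
                  Collect_conv_if doubleton_eq_iff\<close>)
  next
    case False
    then have none: "{e \<in> edges H. v \<in> e} = {}" using hexagon_edge(1)[OF assms] by blast
    show ?thesis unfolding degree_def none using False by simp
  qed
qed

lemma gdist_self: "gdist H v v = 0"
  unfolding gdist_def by (rule Least_equality) auto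

text \<open>
  Without a walk from \<open>u\<close> to \<open>v\<close> the \<open>LEAST\<close> in \<^const>\<open>gdist\<close> would be an unspecified number;
  this is what makes distances in a hexagon meaningful.
\<close>
lemma hexagon_connected:
  assumes "hexagon H" "u \<in> verts H" "v \<in> verts H"
  shows "(u, v) \<in> {(x, y). {x, y} \<in> edges H}\<^sup>*"
proof -
  from assms(1) obtain a b c d e f where *: "verts H = {a, b, c, d, e, f}"
    "edges H = {{a, b}, {b, c}, {c, d}, {d, e}, {e, f}, {f, a}}" by (rule hexagonE)
  let ?R = "{(x, y). {x, y} \<in> edges H}"
  have "(a, b) \<in> ?R" "(b, c) \<in> ?R" "(c, d) \<in> ?R" "(d, e) \<in> ?R" "(e, f) \<in> ?R"
    by (auto simp: *)
  \<comment> \<open>each line prolongs the walk from \<open>a\<close> by one edge\<close>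
  note path = rtrancl.rtrancl_refl[of a ?R] this
  note path = path rtrancl_into_rtrancl[OF path(1,2)]
  note path = path rtrancl_into_rtrancl[OF path(7,3)]
  note path = path rtrancl_into_rtrancl[OF path(8,4)]
  note path = path rtrancl_into_rtrancl[OF path(9,5)]
  note path = path rtrancl_into_rtrancl[OF path(10,6)]
  have "(a, x) \<in> ?R\<^sup>*" if "x \<in> verts H" for x
    using that path unfolding * by blast
  moreover have "sym (?R\<^sup>*)" by (intro sym_rtrancl symI) (simp add: insert_commute)
  ultimately show ?thesis using assms(2,3) by (meson rtrancl_trans symD)
qed

lemma hexagon_gdist_eq_1_iff:
  assumes "hexagon H" "u \<in> verts H" "v \<in> verts H"
  shows "gdist H u v = 1 \<longleftrightarrow> {u, v} \<in> edges H"
proof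
  assume 1: "gdist H u v = 1"
  obtain k where "(u, v) \<in> {(x, y). {x, y} \<in> edges H} ^^ k"
    using hexagon_connected[OF assms] by (meson rtrancl_imp_relpow)
  then have "(u, v) \<in> {(x, y). {x, y} \<in> edges H} ^^ gdist H u v"
    unfolding gdist_def by (rule LeastI)
  with 1 show "{u, v} \<in> edges H" by simp
next
  assume e: "{u, v} \<in> edges H"
  then have "u \<noteq> v" using hexagon_edge(2)[OF assms(1) e] by auto
  with e show "gdist H u v = 1"
    unfolding gdist_def by (intro Least_equality) (auto simp: Suc_le_eq intro!: gr0I)
qed

section \<open>Degrees and indices of spiro chains\<close>

text \<open>
  The vertices \<open>w 2, ..., w n\<close> shared by successive hexagons are the cut vertices of the chain.
  A positive distance \<open>l k\<close> keeps \<open>w k\<close> apart from \<open>w (k - 1)\<close>, so that no vertex lies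
  on three hexagons.
\<close>
locale spiro_hexagon_chain =
  fixes l :: "nat \<Rightarrow> nat" and n :: nat and H :: "nat \<Rightarrow> 'a ugraph" and w :: "nat \<Rightarrow> 'a"
  assumes spiro: "spiro_hexagons l n H w"
    and l_pos: "\<And>k. k \<in> {3..n} \<Longrightarrow> 0 < l k"
begin

abbreviation chain :: "'a ugraph" where "chain \<equiv> hex_union H n"

abbreviation cuts :: "'a set" where "cuts \<equiv> w ` {2..n}"

lemma hexagon: "k \<in> {1..n} \<Longrightarrow> hexagon (H k)"
  using spiro by (simp add: spiro_hexagons_def)

lemma cut_Int: "k \<in> {2..n} \<Longrightarrow> (\<Union>j\<in>{1..k - 1}. verts (H j)) \<inter> verts (H k) = {w k}"
  using spiro by (simp add: spiro_hexagons_def hex_union_def)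

lemma cut_mem_prev: "k \<in> {2..n} \<Longrightarrow> w k \<in> verts (H (k - 1))"
  using spiro by (simp add: spiro_hexagons_def)

lemma cut_mem: "k \<in> {2..n} \<Longrightarrow> w k \<in> verts (H k)"
  using cut_Int by blast

lemma gdist_cuts: "k \<in> {3..n} \<Longrightarrow> gdist (H (k - 1)) (w (k - 1)) (w k) = l k"
  using spiro by (simp add: spiro_hexagons_def)

lemma consecutive_cuts_distinct:
  assumes "k \<in> {3..n}" shows "w (k - 1) \<noteq> w k"
proof
  assume "w (k - 1) = w k"
  then have "l k = 0" using gdist_cuts[OF assms] gdist_self by metis
  with l_pos[OF assms] show False by simp
qed

lemma earlier_Int_subset:
  assumes "1 \<le> j" "j < k" "k \<le> n"
  shows "verts (H j) \<inter> verts (H k) \<subseteq> {w k}"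
proof -
  have "verts (H j) \<subseteq> (\<Union>j\<in>{1..k - 1}. verts (H j))" using assms by (intro UN_upper) auto
  then show ?thesis using cut_Int[of k] assms by auto
qed

text \<open>
  A vertex common to \<open>H j\<close> and \<open>H k\<close> could only be \<open>w k\<close>. That vertex also lies on \<open>H (k - 1)\<close>,
  and the only vertex that \<open>H (k - 1)\<close> can share with the earlier \<open>H j\<close> is \<open>w (k - 1)\<close>.
\<close>
lemma nonadjacent_disjoint:
  assumes "1 \<le> j" "j + 1 < k" "k \<le> n"
  shows "verts (H j) \<inter> verts (H k) = {}"
proof (rule ccontr)
  assume "verts (H j) \<inter> verts (H k) \<noteq> {}"
  then have "w k \<in> verts (H j)" using earlier_Int_subset[of j k] assms by auto
  moreover have "w k \<in> verts (H (k - 1))" using assms by (intro cut_mem_prev) auto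
  moreover have "verts (H j) \<inter> verts (H (k - 1)) \<subseteq> {w (k - 1)}"
    using assms by (intro earlier_Int_subset) auto
  ultimately have "w k \<in> {w (k - 1)}" by (meson IntI subsetD)
  then have "w (k - 1) = w k" by simp
  moreover have "k \<in> {3..n}" using assms by simp
  ultimately show False using consecutive_cuts_distinct by blast
qed

lemma hexagons_through_cut:
  assumes "k \<in> {2..n}"
  shows "{j \<in> {1..n}. w k \<in> verts (H j)} = {k - 1, k}"
proof (intro equalityI subsetI)
  fix j assume "j \<in> {j \<in> {1..n}. w k \<in> verts (H j)}"
  then have j: "1 \<le> j" "j \<le> n" "w k \<in> verts (H j)" by auto
  have "\<not> j < k - 1"
    using nonadjacent_disjoint[of j k] j cut_mem[OF assms] assms by fastforce
  moreover have "\<not> k < j"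
    using nonadjacent_disjoint[of "k - 1" j] j cut_mem_prev[OF assms] assms by fastforce
  ultimately show "j \<in> {k - 1, k}" by auto
qed (use assms cut_mem[OF assms] cut_mem_prev[OF assms] in auto)

lemma inj_cuts: "inj_on w {2..n}"
proof (rule inj_onI)
  fix j k assume jk: "j \<in> {2..n}" "k \<in> {2..n}" "w j = w k"
  then have "{j - 1, j} = {k - 1, k}"
    using hexagons_through_cut[OF jk(1)] hexagons_through_cut[OF jk(2)] by simp
  then show "j = k" using jk(1,2) by (auto simp: doubleton_eq_iff)
qed

lemma card_cuts: "card cuts = n - 1"
  using inj_cuts by (simp add: card_image)

lemma hexagon_through_other_vertex:
  assumes "v \<in> verts chain" "v \<notin> cuts"
  shows "card {j \<in> {1..n}. v \<in> verts (H j)} = 1"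
proof -
  obtain k where k: "k \<in> {1..n}" "v \<in> verts (H k)" using assms(1) by (auto simp: hex_union_def)
  have "j = k" if "j \<in> {1..n}" "v \<in> verts (H j)" for j
  proof (rule ccontr)
    assume "j \<noteq> k"
    then have "v = w (max j k)" "max j k \<in> {2..n}"
      using that k earlier_Int_subset[of j k] earlier_Int_subset[of k j]
      by (auto simp: max_def)
    with assms(2) show False by blast
  qed
  with k have "{j \<in> {1..n}. v \<in> verts (H j)} = {k}" by blast
  then show ?thesis by simp
qed

text \<open>
  Two hexagons share at most one vertex, hence no edge.
\<close>
lemma edges_disjoint: "disjoint_family_on (\<lambda>k. edges (H k)) {1..n}"
proof -
  have False if "1 \<le> j" "j < k" "k \<le> n" "e \<in> edges (H j)" "e \<in> edges (H k)" for j k e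
  proof -
    have "e \<subseteq> verts (H j)" "e \<subseteq> verts (H k)" "card e = 2"
      using hexagon_edge[OF hexagon, of j e] hexagon_edge[OF hexagon, of k e] that by auto
    moreover from this have "e \<subseteq> {w k}" using earlier_Int_subset[of j k] that by blast
    then have "card e \<le> card {w k}" by (intro card_mono) auto
    ultimately show False by simp
  qed
  then show ?thesis
    unfolding disjoint_family_on_def
    by (metis (no_types, lifting) disjoint_iff atLeastAtMost_iff linorder_neqE_nat)
qed

lemma finite_edges: "finite (edges chain)"
  using hexagon_card_edges(1)[OF hexagon] by (simp add: hex_union_def)

lemma finite_verts: "finite (verts chain)"
  using hexagon_card_verts[OF hexagon] by (simp add: hex_union_def)

lemma cuts_subset: "cuts \<subseteq> verts chain"
  using cut_mem by (force simp: hex_union_def)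

lemma edge:
  assumes "e \<in> edges chain" shows "e \<subseteq> verts chain" "card e = 2"
  using assms hexagon_edge[OF hexagon] by (fastforce simp: hex_union_def)+

lemma card_edges: "card (edges chain) = 6 * n"
proof -
  have "card (edges chain) = (\<Sum>k\<in>{1..n}. card (edges (H k)))"
    using edges_disjoint hexagon_card_edges(1)[OF hexagon]
    unfolding hex_union_def ugraph.simps by (intro card_UN_disjoint) (auto simp: disjoint_family_on_def)
  also have "\<dots> = (\<Sum>k\<in>{1..n}. 6)"
    by (intro sum.cong refl hexagon_card_edges(2) hexagon)
  finally show ?thesis by simp
qed

text \<open>
  The hexagons are edge-disjoint, so degrees add up, and each hexagon through \<open>v\<close> contributes 2.
\<close>
lemma degree_chain: "degree chain v = 2 * card {k \<in> {1..n}. v \<in> verts (H k)}"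
proof -
  have "{e \<in> edges chain. v \<in> e} = (\<Union>k\<in>{1..n}. {e \<in> edges (H k). v \<in> e})"
    by (auto simp: hex_union_def)
  then have "degree chain v = card (\<Union>k\<in>{1..n}. {e \<in> edges (H k). v \<in> e})"
    by (simp add: degree_def)
  also have "\<dots> = (\<Sum>k\<in>{1..n}. degree (H k) v)"
    unfolding degree_def using edges_disjoint hexagon_card_edges(1)[OF hexagon]
    by (intro card_UN_disjoint) (auto simp: disjoint_family_on_def)
  also have "\<dots> = (\<Sum>k\<in>{1..n}. if v \<in> verts (H k) then 2 else 0)"
    by (intro sum.cong refl hexagon_degree hexagon)
  also have "\<dots> = 2 * card {k \<in> {1..n}. v \<in> verts (H k)}"
    by (simp add: sum.If_cases Int_def)
  finally show ?thesis .
qed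

lemma degree_eq:
  assumes "v \<in> verts chain" shows "degree chain v = (if v \<in> cuts then 4 else 2)"
proof (cases "v \<in> cuts")
  case True
  then obtain k where k: "k \<in> {2..n}" "v = w k" by blast
  then have "card {j \<in> {1..n}. v \<in> verts (H j)} = 2"
    unfolding k(2) hexagons_through_cut[OF k(1)] by (subst card_insert_disjoint) auto
  with True show ?thesis by (simp only: degree_chain) simp
next
  case False
  then show ?thesis
    unfolding degree_chain hexagon_through_other_vertex[OF assms False] by simp
qed

text \<open>
  Each hexagon after the first adds five vertices, since the sixth is its cut vertex. The
  correction term is 0 only for the empty chain, which makes the induction start at 0.
\<close>
lemma card_verts: "card (verts chain) = 5 * n + of_bool (n > 0)"
proof -
  have "card (verts (hex_union H m)) = 5 * m + of_bool (m > 0)" if "m \<le> n" for m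
    using that
  proof (induction m)
    case 0
    then show ?case by (simp add: hex_union_def)
  next
    case (Suc m)
    let ?V = "verts (hex_union H m)" and ?W = "verts (H (Suc m))"
    have fin: "finite ?V" "finite ?W" "card ?W = 6"
      using Suc.prems hexagon_card_verts[OF hexagon] by (auto simp: hex_union_def)
    have "verts (hex_union H (Suc m)) = ?V \<union> ?W"
      by (simp add: hex_union_def atLeastAtMostSuc_conv Un_commute)
    moreover have "card (?V \<inter> ?W) = of_bool (m > 0)"
    proof (cases "m = 0")
      case False
      then have "?V \<inter> ?W = {w (Suc m)}"
        using cut_Int[of "Suc m"] Suc.prems by (simp add: hex_union_def)
      with False show ?thesis by simp
    qed (simp add: hex_union_def)
    ultimately show ?case
      using card_Un_Int[OF fin(1,2)] Suc fin(3) by simp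
  qed
  then show ?thesis by simp
qed

text \<open>
  Double counting of the incidences between edges and cut vertices: each of the \<open>n - 1\<close> cut
  vertices has degree 4.
\<close>
lemma sum_card_edge_Int_cuts: "(\<Sum>e\<in>edges chain. card (e \<inter> cuts)) = 4 * (n - 1)"
proof -
  have "(\<Sum>e\<in>edges chain. card (e \<inter> cuts)) = (\<Sum>e\<in>edges chain. card {v \<in> cuts. v \<in> e})"
    by (intro sum.cong arg_cong[where f = card]) auto
  also have "\<dots> = (\<Sum>v\<in>cuts. degree chain v)"
    unfolding degree_def by (rule sum_multicount_gen[OF finite_edges]) auto
  also have "\<dots> = (\<Sum>v\<in>cuts. 4)"
    using degree_eq cuts_subset by (intro sum.cong) auto
  finally show ?thesis by (simp add: card_cuts)
qed

text \<open>
  A hexagon contains at most the two cut vertices at its ends, so an edge between cut vertices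
  joins \<open>w (k - 1)\<close> to \<open>w k\<close> inside \<open>H (k - 1)\<close>; it is there exactly when these are at distance 1.
\<close>
lemma edges_within_cuts:
  "{e \<in> edges chain. e \<subseteq> cuts} = (\<lambda>k. {w (k - 1), w k}) ` {k \<in> {3..n}. l k = 1}"
proof (intro equalityI subsetI)
  fix e assume "e \<in> {e \<in> edges chain. e \<subseteq> cuts}"
  then obtain k where k: "k \<in> {1..n}" "e \<in> edges (H k)" and sub: "e \<subseteq> cuts"
    by (auto simp: hex_union_def)
  have e: "e \<subseteq> verts (H k)" "card e = 2" using hexagon_edge[OF hexagon] k by auto
  obtain x y where xy: "e = {x, y}" "x \<noteq> y" using e(2) by (auto simp: card_2_iff)
  have cut: "(v = w k \<and> 2 \<le> k) \<or> (v = w (Suc k) \<and> Suc k \<le> n)" if v: "v \<in> e" for v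
  proof -
    obtain j where j: "j \<in> {2..n}" "v = w j" using v sub by blast
    then have "k \<in> {j - 1, j}" using hexagons_through_cut[OF j(1)] v j(2) e(1) k(1) by blast
    then show ?thesis using j by auto
  qed
  have k3: "Suc k \<in> {3..n}" and e_eq: "e = {w k, w (Suc k)}"
    using cut[of x] cut[of y] xy by auto
  have "gdist (H k) (w k) (w (Suc k)) = 1"
    using hexagon_gdist_eq_1_iff[OF hexagon[OF k(1)]] e(1) k(2) unfolding e_eq by blast
  then have "l (Suc k) = 1" using gdist_cuts[OF k3] by simp
  then show "e \<in> (\<lambda>k. {w (k - 1), w k}) ` {k \<in> {3..n}. l k = 1}"
    using k3 e_eq by (intro rev_image_eqI[of "Suc k"]) auto
next
  fix e assume "e \<in> (\<lambda>k. {w (k - 1), w k}) ` {k \<in> {3..n}. l k = 1}"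
  then obtain k where k: "k \<in> {3..n}" "l k = 1" "e = {w (k - 1), w k}" by blast
  have prev: "k - 1 \<in> {1..n}" "k - 1 \<in> {2..n}" "k \<in> {2..n}" using k(1) by auto
  have "gdist (H (k - 1)) (w (k - 1)) (w k) = 1" using gdist_cuts[OF k(1)] k(2) by simp
  then have "e \<in> edges (H (k - 1))"
    unfolding k(3)
    by (rule iffD1[OF hexagon_gdist_eq_1_iff[OF hexagon[OF prev(1)] cut_mem[OF prev(2)]
          cut_mem_prev[OF prev(3)]]])
  with prev(1) have "e \<in> edges chain" unfolding hex_union_def ugraph.simps by (rule UN_I)
  moreover have "e \<subseteq> cuts" using k(3) prev by simp
  ultimately show "e \<in> {e \<in> edges chain. e \<subseteq> cuts}" by simp
qed

lemma card_edges_within_cuts: "card {e \<in> edges chain. e \<subseteq> cuts} = card {k \<in> {3..n}. l k = 1}"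
proof -
  have "inj_on (\<lambda>k. {w (k - 1), w k}) {k \<in> {3..n}. l k = 1}"
  proof (rule inj_onI)
    fix j k assume jk: "j \<in> {k \<in> {3..n}. l k = 1}" "k \<in> {k \<in> {3..n}. l k = 1}"
      "{w (j - 1), w j} = {w (k - 1), w k}"
    then have "w ` {j - 1, j} = w ` {k - 1, k}" by simp
    then have "{j - 1, j} = {k - 1, k}"
      using jk by (subst (asm) inj_on_image_eq_iff[OF inj_cuts]) auto
    then show "j = k" using jk by (auto simp: doubleton_eq_iff)
  qed
  then show ?thesis by (simp only: edges_within_cuts card_image)
qed

lemma vertex_index_chain:
  assumes "n \<ge> 1"
  shows "vertex_index h a chain =
    (5 * n + 1) * h 2 powr a + (n - 1) * (h 4 powr a - h 2 powr a)"
proof -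
  have "vertex_index h a chain
      = (\<Sum>v\<in>verts chain. h 2 powr a + (if v \<in> cuts then h 4 powr a - h 2 powr a else 0))"
    unfolding vertex_index_def using degree_eq by (intro sum.cong) auto
  also have "\<dots> = card (verts chain) * h 2 powr a + card cuts * (h 4 powr a - h 2 powr a)"
    using finite_verts cuts_subset
    by (simp add: sum.distrib sum.If_cases Int_absorb1)
  finally show ?thesis using assms by (simp add: card_verts card_cuts)
qed

text \<open>
  An edge with \<open>j\<close> ends in cut vertices contributes \<open>t22\<close>, \<open>t24\<close> or \<open>t44\<close> for \<open>j = 0, 1, 2\<close>.
  Interpolating in \<open>j\<close>, this is \<open>t22 + j * (t24 - t22)\<close> plus the second difference
  \<open>t44 - 2 * t24 + t22\<close> if \<open>j = 2\<close>. The linear part sums to a number of incidences that depends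
  on \<open>n\<close> alone, and only the last part sees the cases chosen.
\<close>
lemma edge_index_chain:
  fixes f :: "nat \<Rightarrow> nat \<Rightarrow> real" and a t22 t24 t44 :: real
  assumes "n \<ge> 1" and sym: "f 2 4 = f 4 2"
  defines "t22 \<equiv> f 2 2 powr a" and "t24 \<equiv> f 2 4 powr a" and "t44 \<equiv> f 4 4 powr a"
  shows "edge_index f a chain =
    6 * n * t22 + 4 * (n - 1) * (t24 - t22) + card {k \<in> {3..n}. l k = 1} * (t44 - 2 * t24 + t22)"
proof -
  have edge_value: "(THE t. \<exists>u v. e = {u, v} \<and> t = f (degree chain u) (degree chain v) powr a)
     = t22 + card (e \<inter> cuts) * (t24 - t22) + (if e \<subseteq> cuts then t44 - 2 * t24 + t22 else 0)"
    (is "_ = ?T") if e: "e \<in> edges chain" for e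
  proof -
    have *: "f (degree chain u) (degree chain v) powr a = ?T" if "e = {u, v}" for u v
    proof -
      have "u \<noteq> v" using edge(2)[OF e] that by auto
      moreover have "degree chain u = (if u \<in> cuts then 4 else 2)"
        "degree chain v = (if v \<in> cuts then 4 else 2)"
        using edge(1)[OF e] that degree_eq by blast+
      ultimately show ?thesis
        by (cases "u \<in> cuts"; cases "v \<in> cuts")
           (auto simp: that t22_def t24_def t44_def sym Int_insert_left)
    qed
    obtain u v where uv: "e = {u, v}" using edge(2)[OF e] by (auto simp: card_2_iff)
    show ?thesis
    proof (rule the_equality)
      show "\<exists>u v. e = {u, v} \<and> ?T = f (degree chain u) (degree chain v) powr a"
        using uv *[OF uv] by (intro exI conjI) (rule uv, simp)
    qed (use * in metis)
  qed
  have "edge_index f a chain = (\<Sum>e\<in>edges chain.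
      t22 + card (e \<inter> cuts) * (t24 - t22) + (if e \<subseteq> cuts then t44 - 2 * t24 + t22 else 0))"
    unfolding edge_index_def by (intro sum.cong refl edge_value)
  also have "\<dots> = card (edges chain) * t22 + real (\<Sum>e\<in>edges chain. card (e \<inter> cuts)) * (t24 - t22)
      + card {e \<in> edges chain. e \<subseteq> cuts} * (t44 - 2 * t24 + t22)"
    using finite_edges
    by (simp add: sum.distrib sum_distrib_right sum.If_cases Int_def)
  also have "\<dots> = 6 * n * t22 + 4 * (n - 1) * (t24 - t22)
      + card {k \<in> {3..n}. l k = 1} * (t44 - 2 * t24 + t22)"
    by (simp only: sum_card_edge_Int_cuts card_edges card_edges_within_cuts)
  finally show ?thesis .
qed

end

text \<open>
  The closed form behind the theorem. Attaching one hexagon thus changes the index by \<open>B + C\<close>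
  in case 1 and by \<open>B\<close> in the other two cases, whatever the chain was before.
\<close>
lemma topological_index_chain:
  fixes TI :: "'a ugraph \<Rightarrow> real"
  assumes "topological_index a TI"
  obtains A B C :: real where
    "\<And>l n H w. spiro_hexagons l n H w \<Longrightarrow> \<forall>k\<in>{3..n}. 0 < l k \<Longrightarrow> 1 \<le> n \<Longrightarrow>
       TI (hex_union H n) = A + B * n + C * card {k \<in> {3..n}. l k = 1}"
  using assms unfolding topological_index_def
proof (elim disjE exE conjE)
  fix h assume TI: "TI = vertex_index h a"
  show thesis
  proof (rule that)
    fix l n and H :: "nat \<Rightarrow> 'a ugraph" and w
    assume "spiro_hexagons l n H w" "\<forall>k\<in>{3..n}. 0 < l k" and n: "1 \<le> n"
    then interpret spiro_hexagon_chain l n H w by unfold_locales auto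
    show "TI chain = (2 * h 2 powr a - h 4 powr a) + (4 * h 2 powr a + h 4 powr a) * n
        + 0 * real (card {k \<in> {3..n}. l k = 1})"
      unfolding TI vertex_index_chain[OF n] using n by (simp add: algebra_simps)
  qed
next
  fix f :: "nat \<Rightarrow> nat \<Rightarrow> real"
  assume f: "\<forall>d\<ge>1. \<forall>e\<ge>1. 0 < f d e \<and> f d e = f e d" and TI: "TI = edge_index f a"
  define t22 t24 t44 :: real where "t22 = f 2 2 powr a" and "t24 = f 2 4 powr a" and "t44 = f 4 4 powr a"
  show thesis
  proof (rule that)
    fix l n and H :: "nat \<Rightarrow> 'a ugraph" and w
    assume "spiro_hexagons l n H w" "\<forall>k\<in>{3..n}. 0 < l k" and n: "1 \<le> n"
    then interpret spiro_hexagon_chain l n H w by unfold_locales auto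
    have sym: "f 2 4 = f 4 2" using f by simp
    show "TI chain = - 4 * (t24 - t22) + (2 * t22 + 4 * t24) * n
        + (t44 - 2 * t24 + t22) * card {k \<in> {3..n}. l k = 1}"
      unfolding TI edge_index_chain[OF n sym] t22_def t24_def t44_def
      using n by (simp add: algebra_simps)
  qed
qed

section \<open>Counts of independent trials\<close>

text \<open>
  Listing \<open>K\<close> turns such a function into the word of its values. The prescribed fibre sizes say
  that this word is an arrangement of the multiset containing each \<open>i\<close> exactly \<open>x i\<close> times.
\<close>
lemma card_functions_with_fibre_sizes:
  assumes "finite K" "finite I" "(\<Sum>i\<in>I. x i) = card K"
  shows "real (card {g \<in> K \<rightarrow>\<^sub>E I. \<forall>i\<in>I. card {k \<in> K. g k = i} = x i})
         = fact (card K) / (\<Prod>i\<in>I. fact (x i))"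
proof -
  obtain ks where ks: "set ks = K" "distinct ks" using finite_distinct_list[OF assms(1)] by blast
  define A where "A = Abs_multiset (\<lambda>i. if i \<in> I then x i else 0)"
  have cA: "count A = (\<lambda>i. if i \<in> I then x i else 0)"
    unfolding A_def by (rule Abs_multiset_inverse) (auto intro: finite_subset[OF _ assms(2)])
  have AI: "set_mset A \<subseteq> I" by (auto simp: cA set_mset_def split: if_splits)
  have size: "size A = card K"
    using assms(2,3) AI
    by (simp add: size_multiset_overloaded_eq cA)
       (subst sum.mono_neutral_cong_left[of I], auto simp: cA set_mset_def)
  have prod: "(\<Prod>i\<in>set_mset A. fact (count A i)) = (\<Prod>i\<in>I. fact (x i) :: nat)"
    using assms(2) AI
    by (intro prod.mono_neutral_cong_left) (auto simp: cA not_in_iff simp flip: set_mset_def)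
  have count: "count (mset (map g ks)) i = card {k \<in> K. g k = i}" for g :: "'a \<Rightarrow> 'b" and i
  proof -
    have "count (mset (map g ks)) i = length (filter (\<lambda>k. g k = i) ks)"
      by (induction ks) auto
    also have "\<dots> = card (set (filter (\<lambda>k. g k = i) ks))"
      using ks(2) by (intro distinct_card[symmetric]) simp
    finally show ?thesis using ks(1) by simp
  qed
  have "bij_betw (\<lambda>g. map g ks) {g \<in> K \<rightarrow>\<^sub>E I. \<forall>i\<in>I. card {k \<in> K. g k = i} = x i}
          (permutations_of_multiset A)" (is "bij_betw _ ?F _")
  proof (rule bij_betw_imageI)
    show "inj_on (\<lambda>g. map g ks) ?F"
      using ks(1) by (auto simp: inj_on_def intro: PiE_ext)
    show "(\<lambda>g. map g ks) ` ?F = permutations_of_multiset A"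
    proof (intro equalityI subsetI)
      fix xs assume "xs \<in> (\<lambda>g. map g ks) ` ?F"
      then obtain g where g: "g \<in> ?F" "xs = map g ks" by blast
      have "count (mset xs) i = count A i" for i
      proof (cases "i \<in> I")
        case True
        then show ?thesis using g by (simp only: g(2) count cA) simp
      next
        case False
        then have "{k \<in> K. g k = i} = {}" using g(1) by (auto dest: PiE_mem)
        with False show ?thesis by (simp only: g(2) count cA) simp
      qed
      then show "xs \<in> permutations_of_multiset A"
        by (intro permutations_of_multisetI multiset_eqI)
    next
      fix xs assume "xs \<in> permutations_of_multiset A"
      then have xs: "mset xs = A" by (rule permutations_of_multisetD)
      then have len: "length ks = length xs" by (metis size size_mset distinct_card ks)
      define g where "g = restrict (\<lambda>k. the (map_of (zip ks xs) k)) K"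
      have map: "map g ks = xs"
      proof (rule nth_equalityI)
        fix j assume "j < length (map g ks)"
        then show "map g ks ! j = xs ! j"
          using len ks by (auto simp: g_def map_of_zip_nth)
      qed (simp add: len)
      have "g ` K = set xs" by (simp flip: map ks(1))
      also have "set xs \<subseteq> I" using AI by (simp flip: xs)
      finally have "g \<in> K \<rightarrow>\<^sub>E I" by (auto simp: g_def)
      moreover have "card {k \<in> K. g k = i} = x i" if "i \<in> I" for i
        using that count[of g i] by (simp add: map xs cA del: mset_map)
      ultimately show "xs \<in> (\<lambda>g. map g ks) ` ?F" using map by force
    qed
  qed
  then have "card {g \<in> K \<rightarrow>\<^sub>E I. \<forall>i\<in>I. card {k \<in> K. g k = i} = x i}
     = fact (card K) div (\<Prod>i\<in>I. fact (x i))"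
    using card_permutations_of_multiset(1)[of A] by (simp add: bij_betw_same_card size prod)
  moreover have "(\<Prod>i\<in>I. fact (x i) :: nat) dvd fact (card K)"
    using card_permutations_of_multiset(2)[of A] by (simp add: size prod)
  ultimately show ?thesis by (simp add: real_of_nat_div)
qed

text \<open>
  The event that the counts are \<open>x\<close> splits into the events \<open>E g\<close> that the outcomes are given by
  \<open>g\<close>, where \<open>g\<close> ranges over the functions with fibre sizes \<open>x\<close>. By independence each \<open>E g\<close> has
  the same probability, a product of powers of the \<open>p i\<close>, and the number of such \<open>g\<close> is the
  multinomial coefficient, or 0 if the \<open>x i\<close> do not add up to the number of trials.
\<close>
lemma (in prob_space) multinomial_vector_of_indep_vars:
  fixes L :: "nat \<Rightarrow> 'a \<Rightarrow> 'i" and p :: "'i \<Rightarrow> real"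
  assumes "finite K" "finite I"
    and indep: "indep_vars (\<lambda>_. count_space I) L K"
    and p: "\<And>k i. k \<in> K \<Longrightarrow> i \<in> I \<Longrightarrow> prob {\<omega> \<in> space M. L k \<omega> = i} = p i"
  shows "multinomial_vector M (card K) I p (\<lambda>i \<omega>. card {k \<in> K. L k \<omega> = i})"
proof -
  let ?X = "\<lambda>i \<omega>. card {k \<in> K. L k \<omega> = i}"
  have L: "L k \<in> measurable M (count_space I)" if "k \<in> K" for k
    using indep that by (simp add: indep_vars_def2)
  have LI: "L k \<omega> \<in> I" if "k \<in> K" "\<omega> \<in> space M" for k \<omega>
    using measurable_space[OF L] that by fastforce
  have L_sets: "{\<omega> \<in> space M. k \<in> K \<and> L k \<omega> = i} \<in> events" for k i
  proof (cases "k \<in> K")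
    case True
    have "L k -` ({i} \<inter> I) \<inter> space M \<in> events"
      by (rule measurable_sets[OF L[OF True]]) simp
    also have "L k -` ({i} \<inter> I) \<inter> space M = {\<omega> \<in> space M. k \<in> K \<and> L k \<omega> = i}"
      using True LI by auto
    finally show ?thesis .
  qed simp
  then have X: "?X i \<in> measurable M (count_space UNIV)" for i
    by (intro measurable_card) simp
  have "prob {\<omega> \<in> space M. \<forall>i\<in>I. ?X i \<omega> = x i} =
      (if (\<Sum>i\<in>I. x i) = card K
       then fact (card K) / (\<Prod>i\<in>I. fact (x i)) * (\<Prod>i\<in>I. p i ^ x i) else 0)" for x
  proof -
    define F where "F = {g \<in> K \<rightarrow>\<^sub>E I. \<forall>i\<in>I. card {k \<in> K. g k = i} = x i}"
    have fin: "finite F" unfolding F_def by (simp add: assms finite_PiE)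
    define E where "E g = {\<omega> \<in> space M. \<forall>k\<in>K. L k \<omega> = g k}" for g
    have E_sets: "E g \<in> events" for g
    proof -
      have "E g = {\<omega> \<in> space M. \<forall>k\<in>K. k \<in> K \<and> L k \<omega> = g k}" by (auto simp: E_def)
      also have "\<dots> \<in> events" by (intro sets.sets_Collect_finite_All L_sets \<open>finite K\<close>)
      finally show ?thesis .
    qed
    have prob_E: "prob (E g) = (\<Prod>k\<in>K. p (g k))" if "g \<in> K \<rightarrow>\<^sub>E I" for g
    \<comment> \<open>the product rule for independent variables concerns nonempty index sets\<close>
    proof (cases "K = {}")
      case True
      then show ?thesis by (simp add: E_def prob_space)
    next
      case False
      have "E g = (\<Inter>k\<in>K. L k -` {g k} \<inter> space M)" using False by (auto simp: E_def)
      also have "prob \<dots> = (\<Prod>k\<in>K. prob (L k -` {g k} \<inter> space M))"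
        using that by (intro indep_varsD[OF indep False \<open>finite K\<close>]) auto
      also have "\<dots> = (\<Prod>k\<in>K. p (g k))"
      proof (rule prod.cong[OF refl])
        fix k assume k: "k \<in> K"
        have "L k -` {g k} \<inter> space M = {\<omega> \<in> space M. L k \<omega> = g k}" by auto
        then show "prob (L k -` {g k} \<inter> space M) = p (g k)"
          using p[OF k, of "g k"] that k by auto
      qed
      finally show ?thesis .
    qed
    have fibres: "(\<Prod>k\<in>K. p (g k)) = (\<Prod>i\<in>I. p i ^ x i)" if "g \<in> F" for g
    proof -
      have "(\<Prod>k\<in>K. p (g k)) = (\<Prod>i\<in>I. \<Prod>k\<in>{k \<in> K. g k = i}. p (g k))"
        using that by (intro prod.group[symmetric] assms) (auto simp: F_def)
      also have "\<dots> = (\<Prod>i\<in>I. p i ^ x i)"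
        using that by (intro prod.cong) (auto simp: F_def)
      finally show ?thesis .
    qed
    have "{\<omega> \<in> space M. \<forall>i\<in>I. ?X i \<omega> = x i} = (\<Union>g\<in>F. E g)"
    proof (intro equalityI subsetI)
      fix \<omega> assume \<omega>: "\<omega> \<in> {\<omega> \<in> space M. \<forall>i\<in>I. ?X i \<omega> = x i}"
      let ?g = "restrict (\<lambda>k. L k \<omega>) K"
      have "{k \<in> K. ?g k = i} = {k \<in> K. L k \<omega> = i}" for i by auto
      then have "?g \<in> F" using \<omega> LI by (auto simp: F_def)
      moreover have "\<omega> \<in> E ?g" using \<omega> by (auto simp: E_def)
      ultimately show "\<omega> \<in> (\<Union>g\<in>F. E g)" by blast
    next
      fix \<omega> assume "\<omega> \<in> (\<Union>g\<in>F. E g)"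
      then obtain g where g: "g \<in> F" and \<omega>: "\<omega> \<in> space M" "\<forall>k\<in>K. L k \<omega> = g k"
        by (auto simp: E_def)
      have "{k \<in> K. L k \<omega> = i} = {k \<in> K. g k = i}" for i using \<omega>(2) by auto
      then show "\<omega> \<in> {\<omega> \<in> space M. \<forall>i\<in>I. ?X i \<omega> = x i}" using \<omega>(1) g by (simp add: F_def)
    qed
    moreover have "disjoint_family_on E F"
    proof (unfold disjoint_family_on_def, intro ballI impI equals0I)
      fix g g' \<omega> assume g: "g \<in> F" "g' \<in> F" "g \<noteq> g'" and \<omega>: "\<omega> \<in> E g \<inter> E g'"
      have "g k = g' k" if "k \<in> K" for k using \<omega> that by (auto simp: E_def)
      then have "g = g'" using g(1,2) unfolding F_def by (blast intro: PiE_ext)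
      with g(3) show False by contradiction
    qed
    ultimately have "prob {\<omega> \<in> space M. \<forall>i\<in>I. ?X i \<omega> = x i} = (\<Sum>g\<in>F. prob (E g))"
      using finite_measure_finite_Union[OF fin] E_sets by (simp add: image_subset_iff)
    also have "\<dots> = (\<Sum>g\<in>F. \<Prod>i\<in>I. p i ^ x i)"
      using prob_E fibres by (intro sum.cong) (auto simp: F_def)
    also have "\<dots> = real (card F) * (\<Prod>i\<in>I. p i ^ x i)" by simp
    also have "real (card F) =
        (if (\<Sum>i\<in>I. x i) = card K then fact (card K) / (\<Prod>i\<in>I. fact (x i)) else 0)"
    proof (cases "(\<Sum>i\<in>I. x i) = card K")
      case True
      then show ?thesis
        using card_functions_with_fibre_sizes[OF \<open>finite K\<close> \<open>finite I\<close> True] by (simp add: F_def)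
    next
      case False
      have "(\<Sum>i\<in>I. x i) = card K" if "g \<in> F" for g
      proof -
        have "(\<Sum>i\<in>I. x i) = (\<Sum>i\<in>I. \<Sum>k\<in>{k \<in> K. g k = i}. 1)"
          using that by (intro sum.cong) (auto simp: F_def)
        also have "\<dots> = (\<Sum>k\<in>K. 1)"
          using that by (intro sum.group assms) (auto simp: F_def)
        finally show ?thesis by simp
      qed
      with False have "F = {}" by blast
      with False show ?thesis by simp
    qed
    finally show ?thesis by simp
  qed
  with X show ?thesis by (simp add: multinomial_vector_def)
qed

section \<open>Topological indices of random spiro chains\<close>

theorem theorem3:
  fixes M :: "'w measure"
    and p :: "nat \<Rightarrow> real"
    and L :: "nat \<Rightarrow> 'w \<Rightarrow> nat"
    and RSC :: "nat \<Rightarrow> 'w \<Rightarrow> 'a ugraph"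
    and a\<^sub>0 :: real
    and TI :: "'a ugraph \<Rightarrow> real"
    and n :: nat
    and RSC2 :: "'a ugraph"
    and RSC3 :: "nat \<Rightarrow> 'a ugraph"
    and \<alpha> :: "nat \<Rightarrow> real"
  assumes "random_spiro_chain M p L RSC"
    and "topological_index a\<^sub>0 TI"
    and "n \<ge> 2"
    and "\<And>l. spiro_chain l 2 RSC2"
    and "\<And>i. i \<in> {1, 2, 3} \<Longrightarrow> spiro_chain (\<lambda>_. i) 3 (RSC3 i)"
    and "\<And>i. i \<in> {1, 2, 3} \<Longrightarrow> \<alpha> i = TI (RSC3 i) - TI RSC2"
  shows "\<exists>X :: nat \<Rightarrow> 'w \<Rightarrow> nat.
           multinomial_vector M (n - 2) {1, 2, 3} p X \<and>
           (\<forall>\<omega>\<in>space M. TI (RSC n \<omega>) = TI RSC2 + (\<Sum>i\<in>{1, 2, 3}. \<alpha> i * real (X i \<omega>)))"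
proof -
  interpret random_spiro_chain M p L RSC by fact
  have L_range: "L k \<omega> \<in> {1, 2, 3}" if "k \<ge> 3" "\<omega> \<in> space M" for k \<omega>
  proof -
    have "L k \<in> measurable M (count_space {1, 2, 3})"
      using L_indep that(1) by (auto simp: indep_vars_def2)
    from measurable_space[OF this that(2)] show ?thesis by simp
  qed
  obtain A B C :: real where TI: "\<And>l n H w. spiro_hexagons l n H w \<Longrightarrow> \<forall>k\<in>{3..n}. 0 < l k \<Longrightarrow> 1 \<le> n \<Longrightarrow>
       TI (hex_union H n) = A + B * n + C * card {k \<in> {3..n}. l k = 1}"
    using topological_index_chain[OF assms(2)] by blast
  have TI_RSC2: "TI RSC2 = A + B * 2"
  proof -
    obtain H w where "spiro_hexagons (\<lambda>_. 1) 2 H w" "RSC2 = hex_union H 2"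
      using assms(4)[of "\<lambda>_. 1"] by (auto simp: spiro_chain_def)
    then show ?thesis using TI[of "\<lambda>_. 1" 2 H w] by simp
  qed
  have \<alpha>: "\<alpha> i = B + C * of_bool (i = 1)" if i: "i \<in> {1, 2, 3}" for i
  proof -
    obtain H w where "spiro_hexagons (\<lambda>_. i) 3 H w" "RSC3 i = hex_union H 3"
      using assms(5)[OF i] by (auto simp: spiro_chain_def)
    moreover have "{k \<in> {3..3::nat}. i = 1} = (if i = 1 then {3} else {})" by auto
    ultimately have "TI (RSC3 i) = A + B * 3 + C * of_bool (i = 1)"
      using TI[of "\<lambda>_. i" 3 H w] i by (auto split: if_splits)
    then show ?thesis using assms(6)[OF i] TI_RSC2 by simp
  qed
  define X where "X i \<omega> = card {k \<in> {3..n}. L k \<omega> = i}" for i \<omega>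
  have "multinomial_vector M (card {3..n}) {1, 2, 3} p X"
    unfolding X_def
    by (rule multinomial_vector_of_indep_vars)
       (use L_prob indep_vars_subset[OF L_indep] in auto)
  moreover have "card {3..n} = n - 2" by simp
  moreover have "TI (RSC n \<omega>) = TI RSC2 + (\<Sum>i\<in>{1, 2, 3}. \<alpha> i * real (X i \<omega>))"
    if \<omega>: "\<omega> \<in> space M" for \<omega>
  proof -
    obtain H w where H: "spiro_hexagons (\<lambda>k. L k \<omega>) n H w" "RSC n \<omega> = hex_union H n"
      using chain[OF \<omega>] \<open>n \<ge> 2\<close> by (meson le_trans one_le_numeral)
    have "0 < L k \<omega>" if "k \<in> {3..n}" for k using L_range[of k \<omega>] \<omega> that by auto
    then have index: "TI (RSC n \<omega>) = A + B * n + C * X 1 \<omega>"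
      using TI[OF H(1)] H(2) \<open>n \<ge> 2\<close> by (simp add: X_def)
    have "(\<Sum>i\<in>{1, 2, 3}. X i \<omega>) = (\<Sum>i\<in>{1, 2, 3}. \<Sum>k\<in>{k \<in> {3..n}. L k \<omega> = i}. 1)"
      by (simp add: X_def)
    also have "\<dots> = (\<Sum>k\<in>{3..n}. 1)"
    proof (rule sum.group)
      show "(\<lambda>k. L k \<omega>) ` {3..n} \<subseteq> {1, 2, 3}"
        using L_range \<omega> by (intro image_subsetI) simp
    qed auto
    finally have "real (X 1 \<omega>) + real (X 2 \<omega>) + real (X 3 \<omega>) = real n - 2"
      using \<open>n \<ge> 2\<close> by simp
    then have n_eq: "real n = 2 + X 1 \<omega> + X 2 \<omega> + X 3 \<omega>" by simp
    show ?thesis unfolding index TI_RSC2 n_eq by (simp add: \<alpha> algebra_simps)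
  qed
  ultimately show ?thesis by auto
qed

end
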